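(* Let $0\le\underline\sigma\le\overline\sigma$ and let $W\sim\hat N(0,[\underline\sigma^2,\overline\sigma^2])$ be a semi-$G$-normally distributed random variable on a sublinear expectation space $(\Omega,\mathcal H,\hat{\mathbb E})$. Then for every $\varphi\in C_{l.Lip}(\mathbb R)$, $$\hat{\mathbb E}[\varphi(W)]=\max_{z\in[\underline\sigma,\overline\sigma]}E[\varphi(N(0,z^2))]=\max_{z\in[\underline\sigma,\overline\sigma]}\int_{-\infty}^{\infty}\frac1{\sqrt{2\pi}}e^{-y^2/2}\varphi(zy)\,dy .$$
   Context: $C_{l.Lip}(\mathbb R^d)$ is the space of functions $\varphi:\mathbb R^d\to\mathbb R$ for which there are $C_\varphi>0$ and $k\in\mathbb N$ with $|\varphi(x)-\varphi(y)|\le C_\varphi(1+|x|^k+|y|^k)|x-y|$ for all $x,y$. Sublinear expectation space $(\Omega,\mathcal H,\hat{\mathbb E})$: $\Omega$ is a set; $\mathcal H$ is a linear space of real functions on $\Omega$ containing the constants, with $|X|\in\mathcal H$ whenever $X\in\mathcal H$, and with $\varphi(X_1,\dots,X_d)\in\mathcal H$ whenever $X_1,\dots,X_d\in\mathcal H$ and $\varphi\in C_{l.Lip}(\mathbb R^d)$; $\hat{\mathbb E}:\mathcal H\to\mathbb R$ satisfies monotonicity ($X\ge Y\Rightarrow\hat{\mathbb E}[X]\ge\hat{\mathbb E}[Y]$), constant preservation ($\hat{\mathbb E}[c]=c$), sub-additivity ($\hat{\mathbb E}[X+Y]\le\hat{\mathbb E}[X]+\hat{\mathbb E}[Y]$)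 and positive homogeneity ($\hat{\mathbb E}[\lambda X]=\lambda\hat{\mathbb E}[X]$ for $\lambda\ge0$). Independence: $Y$ is independent from $X$ (written $X\dashrightarrow Y$; the order matters) if for all $\varphi\in C_{l.Lip}$, $\hat{\mathbb E}[\varphi(X,Y)]=\hat{\mathbb E}\big[\hat{\mathbb E}[\varphi(x,Y)]_{x=X}\big]$. Maximal distribution: $Z\sim M[\underline\sigma,\overline\sigma]$ means $\hat{\mathbb E}[\varphi(Z)]=\max_{v\in[\underline\sigma,\overline\sigma]}\varphi(v)$ for all $\varphi\in C_{l.Lip}(\mathbb R)$. Classical standard normal inside the sublinear space: $Y\sim N(0,[1,1])$ means $\hat{\mathbb E}[\varphi(Y)]=\int_{\mathbb R}\frac1{\sqrt{2\pi}}e^{-y^2/2}\varphi(y)\,dy$ for all $\varphi\in C_{l.Lip}(\mathbb R)$. Semi-$G$-normal distribution: $W\sim\hat N(0,[\underline\sigma^2,\overline\sigma^2])$ if there exist $Y\sim N(0,[1,1])$ and $Z\sim M[\underline\sigma,\overline\sigma]$ with $Z\dashrightarrow Y$ such that $W=Z\cdot Y$. $E$ denotes the classical linear expectation, and $E[\varphi(N(\mu,s^2))]$ denotes the expectation of $\varphi$ of a classical normal random variable with mean $\mu$ and variance $s^2$ (point mass at $\mu$ if $s=0$). *)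

theory Defs
  imports "HOL-Probability.Probability"
begin

definition C_lLip :: "('a::euclidean_space \<Rightarrow> real) set" where
  "C_lLip = {\<phi>. \<exists>C>0. \<exists>k::nat. \<forall>x y.
     \<bar>\<phi> x - \<phi> y\<bar> \<le> C * (1 + norm x ^ k + norm y ^ k) * norm (x - y)}"

text \<open>
  The same space over \<open>\<real>\<^sup>d\<close> for a dimension \<open>d\<close> that is a natural number rather than a type: a point
  is given by the first \<open>d\<close> values of a sequence. Sequences that agree below \<open>d\<close> have distance \<open>0\<close>,
  so the inequality forces \<open>\<phi>\<close> to depend on those \<open>d\<close> values only.
\<close>

definition C_lLip_dim :: "nat \<Rightarrow> ((nat \<Rightarrow> real) \<Rightarrow> real) set" where
  "C_lLip_dim d = {\<phi>. \<exists>C>0. \<exists>k::nat. \<forall>x y.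
     \<bar>\<phi> x - \<phi> y\<bar> \<le> C * (1 + L2_set x {..<d} ^ k + L2_set y {..<d} ^ k)
       * L2_set (\<lambda>i. x i - y i) {..<d}}"

lemma C_lLip_dim_1: "(\<lambda>x. \<phi> (x 0)) \<in> C_lLip_dim 1 \<longleftrightarrow> \<phi> \<in> (C_lLip :: (real \<Rightarrow> real) set)"
proof -
  have *: "(\<forall>(x :: nat \<Rightarrow> real) (y :: nat \<Rightarrow> real). P (x 0) (y 0)) \<longleftrightarrow> (\<forall>x y. P x y)" for P :: "real \<Rightarrow> real \<Rightarrow> bool"
    by (auto dest: spec2[of _ "\<lambda>_. _" "\<lambda>_. _"])
  have L: "L2_set x {..<1} = norm (x 0)" for x :: "nat \<Rightarrow> real"
    by (simp add: L2_set_def)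
  show ?thesis
    unfolding C_lLip_def C_lLip_dim_def L mem_Collect_eq
    by (subst *[of "\<lambda>x y. \<bar>\<phi> x - \<phi> y\<bar> \<le> C * (1 + norm x ^ k + norm y ^ k) * norm (x - y)" for C k])
      (rule refl)
qed

lemma C_lLip_dim_2:
  "(\<lambda>x. \<phi> (x 0, x 1)) \<in> C_lLip_dim 2 \<longleftrightarrow> \<phi> \<in> (C_lLip :: (real \<times> real \<Rightarrow> real) set)"
proof -
  have *: "(\<forall>(x :: nat \<Rightarrow> real) (y :: nat \<Rightarrow> real). P (x 0, x 1) (y 0, y 1)) \<longleftrightarrow> (\<forall>x y. P x y)"
    for P :: "real \<times> real \<Rightarrow> real \<times> real \<Rightarrow> bool"
  proof
    assume H: "\<forall>(x :: nat \<Rightarrow> real) (y :: nat \<Rightarrow> real). P (x 0, x 1) (y 0, y 1)"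
    show "\<forall>x y. P x y"
    proof (intro allI)
      fix x y :: "real \<times> real"
      obtain a b c d where [simp]: "x = (a, b)" "y = (c, d)"
        by (cases x; cases y) auto
      show "P x y"
        using H[rule_format, of "\<lambda>i. if i = 0 then a else b" "\<lambda>i. if i = 0 then c else d"]
        by auto
    qed
  qed simp
  have L: "L2_set x {..<2} = norm (x 0, x 1)" for x :: "nat \<Rightarrow> real"
    by (simp add: L2_set_def norm_Pair lessThan_nat_numeral lessThan_Suc add.commute)
  show ?thesis
    unfolding C_lLip_def C_lLip_dim_def L mem_Collect_eq
    using *[of "\<lambda>x y. \<bar>\<phi> x - \<phi> y\<bar> \<le> C * (1 + norm x ^ k + norm y ^ k) * norm (x - y)" for C k]
    by simp
qed

text \<open>
  The sample space is the type \<open>'w\<close>. The functional is a total function on \<open>'w \<Rightarrow> real\<close>, but only its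
  values on \<open>\<H>\<close> are constrained.
\<close>

locale sublinear_expectation_space =
  fixes \<H> :: "('w \<Rightarrow> real) set" and \<E> :: "('w \<Rightarrow> real) \<Rightarrow> real"
  assumes const_mem: "(\<lambda>_. c) \<in> \<H>"
    and add_mem: "X \<in> \<H> \<Longrightarrow> Y \<in> \<H> \<Longrightarrow> (\<lambda>\<omega>. X \<omega> + Y \<omega>) \<in> \<H>"
    and scale_mem: "X \<in> \<H> \<Longrightarrow> (\<lambda>\<omega>. c * X \<omega>) \<in> \<H>"
    and abs_mem: "X \<in> \<H> \<Longrightarrow> (\<lambda>\<omega>. \<bar>X \<omega>\<bar>) \<in> \<H>"
    and C_lLip_mem: "(\<And>i. i < d \<Longrightarrow> Xs i \<in> \<H>) \<Longrightarrow> \<phi> \<in> C_lLip_dim d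
      \<Longrightarrow> (\<lambda>\<omega>. \<phi> (\<lambda>i. Xs i \<omega>)) \<in> \<H>"
    and mono: "X \<in> \<H> \<Longrightarrow> Y \<in> \<H> \<Longrightarrow> (\<And>\<omega>. X \<omega> \<ge> Y \<omega>) \<Longrightarrow> \<E> X \<ge> \<E> Y"
    and const: "\<E> (\<lambda>_. c) = c"
    and subadditive: "X \<in> \<H> \<Longrightarrow> Y \<in> \<H> \<Longrightarrow> \<E> (\<lambda>\<omega>. X \<omega> + Y \<omega>) \<le> \<E> X + \<E> Y"
    and pos_homogeneous: "X \<in> \<H> \<Longrightarrow> c \<ge> 0 \<Longrightarrow> \<E> (\<lambda>\<omega>. c * X \<omega>) = c * \<E> X"

text \<open>\<open>is_max_on S f m\<close>: the maximum of \<open>f\<close> over \<open>S\<close> exists, i.e. is attained, and equals \<open>m\<close>.\<close>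

definition is_max_on :: "'a set \<Rightarrow> ('a \<Rightarrow> real) \<Rightarrow> real \<Rightarrow> bool" where
  "is_max_on S f m \<longleftrightarrow> (\<exists>s\<in>S. f s = m) \<and> (\<forall>s\<in>S. f s \<le> m)"

text \<open>
  \<open>independent_from \<E> Y X\<close>: \<open>Y\<close> is independent from \<open>X\<close>, written \<open>X\<close> \<open>\<dashrightarrow>\<close> \<open>Y\<close>. The relation
  is not symmetric.
\<close>

definition independent_from ::
  "(('w \<Rightarrow> real) \<Rightarrow> real) \<Rightarrow> ('w \<Rightarrow> real) \<Rightarrow> ('w \<Rightarrow> real) \<Rightarrow> bool" where
  "independent_from \<E> Y X \<longleftrightarrow> (\<forall>\<phi> \<in> (C_lLip :: (real \<times> real \<Rightarrow> real) set).
     \<E> (\<lambda>\<omega>. \<phi> (X \<omega>, Y \<omega>)) = \<E> (\<lambda>\<omega>. \<E> (\<lambda>\<omega>'. \<phi> (X \<omega>, Y \<omega>'))))"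

definition maximal_distributed ::
  "(('w \<Rightarrow> real) \<Rightarrow> real) \<Rightarrow> ('w \<Rightarrow> real) \<Rightarrow> real \<Rightarrow> real \<Rightarrow> bool" where
  "maximal_distributed \<E> Z l u \<longleftrightarrow>
     (\<forall>\<phi> \<in> C_lLip. is_max_on {l..u} \<phi> (\<E> (\<lambda>\<omega>. \<phi> (Z \<omega>))))"

text \<open>
  Functions in \<open>C_lLip\<close> are continuous with polynomial growth, so the Gaussian integrals below
  converge absolutely.
\<close>

definition standard_normal_distributed ::
  "(('w \<Rightarrow> real) \<Rightarrow> real) \<Rightarrow> ('w \<Rightarrow> real) \<Rightarrow> bool" where
  "standard_normal_distributed \<E> Y \<longleftrightarrow> (\<forall>\<phi> \<in> C_lLip.
     \<E> (\<lambda>\<omega>. \<phi> (Y \<omega>)) = (\<integral>y. 1 / sqrt (2 * pi) * exp (- y\<^sup>2 / 2) * \<phi> y \<partial>lborel))"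

text \<open>
  \<open>semi_G_normal \<H> \<E> W l u\<close> is the semi-\<open>G\<close>-normal law with variance interval \<open>[l\<^sup>2, u\<^sup>2]\<close>; the
  parameters \<open>l\<close> and \<open>u\<close> are the standard deviations.
\<close>

definition semi_G_normal ::
  "('w \<Rightarrow> real) set \<Rightarrow> (('w \<Rightarrow> real) \<Rightarrow> real) \<Rightarrow> ('w \<Rightarrow> real) \<Rightarrow> real \<Rightarrow> real \<Rightarrow> bool" where
  "semi_G_normal \<H> \<E> W l u \<longleftrightarrow> (\<exists>Y\<in>\<H>. \<exists>Z\<in>\<H>.
     standard_normal_distributed \<E> Y \<and> maximal_distributed \<E> Z l u \<and>
     independent_from \<E> Y Z \<and> W = (\<lambda>\<omega>. Z \<omega> * Y \<omega>))"

text \<open>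
  The classical normal law with mean \<open>\<mu>\<close> and variance \<open>v\<close>. The library's \<open>normal_density\<close> takes the
  standard deviation.
\<close>

definition normal_law :: "real \<Rightarrow> real \<Rightarrow> real measure" where
  "normal_law \<mu> v = (if v = 0 then return borel \<mu> else density lborel (normal_density \<mu> (sqrt v)))"

end

theory Submission
  imports Defs
begin

text \<open>
  For fixed \<open>z\<close>, the law of \<open>Y\<close> turns the inner expectation of \<open>\<phi> (z * Y)\<close> into the Gaussian
  integral \<open>G z\<close>. Integrating the local Lipschitz bound of \<open>\<phi>\<close> against the Gaussian moments shows
  that \<open>G\<close> is again locally Lipschitz with polynomial growth, so the maximal distribution of \<open>Z\<close>
  applies to \<open>G\<close>; the independence of \<open>Y\<close> from \<open>Z\<close> joins the two steps.
\<close>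

section \<open>Locally Lipschitz functions of polynomial growth\<close>

lemma C_lLipE:
  assumes "\<phi> \<in> C_lLip"
  obtains C k where "C > 0"
    "\<And>x y. \<bar>\<phi> x - \<phi> y\<bar> \<le> C * (1 + norm x ^ k + norm y ^ k) * norm (x - y)"
  using assms unfolding C_lLip_def by blast

lemma C_lLipI:
  assumes "C > 0"
    "\<And>x y. \<bar>\<phi> x - \<phi> y\<bar> \<le> C * (1 + norm x ^ k + norm y ^ k) * norm (x - y)"
  shows "\<phi> \<in> C_lLip"
  using assms unfolding C_lLip_def by blast

text \<open>The Lipschitz bound tends to 0 as \<open>y\<close> approaches \<open>x\<close>.
  Continuity serves to make \<open>\<phi>\<close> Borel measurable in the integrals below.\<close>

lemma C_lLip_imp_continuous:
  fixes \<phi> :: "'a::euclidean_space \<Rightarrow> real"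
  assumes "\<phi> \<in> C_lLip"
  shows "continuous_on UNIV \<phi>"
proof -
  obtain C k where C: "\<And>x y. \<bar>\<phi> x - \<phi> y\<bar> \<le> C * (1 + norm x ^ k + norm y ^ k) * norm (x - y)"
    using C_lLipE[OF assms] by metis
  have "(\<phi> \<longlongrightarrow> \<phi> x) (at x)" for x
  proof -
    have "((\<lambda>y. C * (1 + norm y ^ k + norm x ^ k) * norm (y - x))
        \<longlongrightarrow> C * (1 + norm x ^ k + norm x ^ k) * norm (x - x)) (at x)"
      by (intro tendsto_intros)
    then have "((\<lambda>y. C * (1 + norm y ^ k + norm x ^ k) * norm (y - x)) \<longlongrightarrow> 0) (at x)"
      by simp
    then have "((\<lambda>y. \<phi> y - \<phi> x) \<longlongrightarrow> 0) (at x)"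
      by (rule Lim_null_comparison[rotated]) (use C in auto)
    then show ?thesis
      by (simp add: LIM_zero_iff)
  qed
  then show ?thesis
    by (simp add: continuous_on_def)
qed

text \<open>This makes \<open>\<phi> (z * y)\<close> an admissible test function of the pair in the
  definition of independence. The degree rises from \<open>k\<close> to \<open>2 * k + 1\<close>:
  products are bounded by the squared norm, and the product map has a local Lipschitz constant of
  linear growth.\<close>

lemma C_lLip_mult:
  assumes "\<phi> \<in> C_lLip"
  shows "(\<lambda>p. \<phi> (fst p * snd p)) \<in> (C_lLip :: (real \<times> real \<Rightarrow> real) set)"
proof -
  obtain C k where "C > 0" and
    C: "\<And>x y. \<bar>\<phi> x - \<phi> y\<bar> \<le> C * (1 + norm x ^ k + norm y ^ k) * norm (x - y)"
    using C_lLipE[OF assms] by metis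
  have abs_fst_le: "\<bar>fst p\<bar> \<le> norm p" and abs_snd_le: "\<bar>snd p\<bar> \<le> norm p" for p :: "real \<times> real"
    using norm_fst_le[of "fst p" "snd p"] norm_snd_le[of "snd p" "fst p"] by simp_all
  have prod_le: "\<bar>fst p * snd p\<bar> \<le> (norm p)\<^sup>2" for p :: "real \<times> real"
    using abs_fst_le[of p] abs_snd_le[of p]
    by (simp add: abs_mult power2_eq_square mult_mono)
  show ?thesis
  proof (rule C_lLipI)
    show "6 * C > 0" using \<open>C > 0\<close> by simp
    fix p q :: "real \<times> real"
    \<comment> \<open>Bounding everything by the larger norm \<open>t\<close> leaves powers of a
      single number; \<open>t ^ m\<close> is one of the two norm powers, so the bound can be turned
      back.\<close>
    define t where "t = max (norm p) (norm q)"
    define m where "m = 2 * k + 1"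
    have t: "norm p \<le> t" "norm q \<le> t" "0 \<le> t"
      unfolding t_def by (auto simp: le_max_iff_disj)
    have "t ^ m = norm p ^ m \<or> t ^ m = norm q ^ m"
      unfolding t_def by (auto simp: max_def)
    then have tm: "t ^ m \<le> norm p ^ m + norm q ^ m"
      by (smt (verit) norm_ge_zero zero_le_power)
    \<comment> \<open>Absorbs the stray linear term \<open>2 * t\<close> of the final estimate:
      \<open>2 * t + 4 * t ^ m\<close> is at most \<open>2 + 6 * t ^ m\<close>, whence the factor 6.
      For \<open>t > 1\<close> this relies on \<open>m\<close> being positive.\<close>
    have t1: "t \<le> 1 + t ^ m"
    proof (cases "t \<le> 1")
      case False
      then have "t \<le> t ^ m" by (intro self_le_power) (auto simp: m_def)
      then show ?thesis by simp
    next
      case True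
      then show ?thesis using zero_le_power[OF t(3), of m] by linarith
    qed
    have pow: "norm (fst r * snd r) ^ k \<le> t ^ (2 * k)" if "norm r \<le> t" for r :: "real \<times> real"
    proof -
      have "norm (fst r * snd r) ^ k \<le> ((norm r)\<^sup>2) ^ k"
        using prod_le by (intro power_mono) auto
      also have "\<dots> \<le> (t\<^sup>2) ^ k"
        using that by (intro power_mono) auto
      finally show ?thesis by (simp add: power_mult)
    qed
    \<comment> \<open>Insert the mixed term \<open>fst p * snd q\<close>.\<close>
    have "fst p * snd p - fst q * snd q
        = fst p * (snd p - snd q) + snd q * (fst p - fst q)"
      by (simp add: algebra_simps)
    then have "\<bar>fst p * snd p - fst q * snd q\<bar>
        \<le> \<bar>fst p\<bar> * \<bar>snd p - snd q\<bar> + \<bar>snd q\<bar> * \<bar>fst p - fst q\<bar>"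
      by (metis abs_mult abs_triangle_ineq)
    also have "\<dots> \<le> t * norm (p - q) + t * norm (p - q)"
      using abs_fst_le[of p] abs_snd_le[of q] abs_fst_le[of "p - q"] abs_snd_le[of "p - q"] t
      by (intro add_mono mult_mono) auto
    finally have diff: "norm (fst p * snd p - fst q * snd q) \<le> 2 * t * norm (p - q)"
      by simp
    have "\<bar>\<phi> (fst p * snd p) - \<phi> (fst q * snd q)\<bar>
        \<le> C * (1 + norm (fst p * snd p) ^ k + norm (fst q * snd q) ^ k)
          * norm (fst p * snd p - fst q * snd q)"
      by (rule C)
    also have "\<dots> \<le> C * (1 + t ^ (2 * k) + t ^ (2 * k)) * (2 * t * norm (p - q))"
      using \<open>C > 0\<close> t(3) pow[OF t(1)] pow[OF t(2)] diff
      by (intro mult_mono mult_left_mono add_mono) auto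
    also have "\<dots> = C * (2 * t + 4 * t ^ m) * norm (p - q)"
      unfolding m_def by (simp add: algebra_simps)
    also have "\<dots> \<le> C * (6 * (1 + norm p ^ m + norm q ^ m)) * norm (p - q)"
      using \<open>C > 0\<close> tm t1 by (intro mult_right_mono mult_left_mono) auto
    finally show "\<bar>\<phi> (fst p * snd p) - \<phi> (fst q * snd q)\<bar>
        \<le> 6 * C * (1 + norm p ^ m + norm q ^ m) * norm (p - q)"
      by (simp only: mult.left_commute[of C 6] mult.assoc)
  qed
qed

lemma C_lLip_scale:
  fixes \<phi> :: "real \<Rightarrow> real"
  assumes "\<phi> \<in> C_lLip"
  shows "(\<lambda>y. \<phi> (z * y)) \<in> C_lLip"
proof -
  obtain C k where "C > 0" and
    C: "\<And>x y. \<bar>\<phi> x - \<phi> y\<bar> \<le> C * (1 + norm x ^ k + norm y ^ k) * norm (x - y)"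
    using C_lLipE[OF assms] by metis
  define M where "M = 1 + \<bar>z\<bar> ^ k"
  have M: "1 \<le> M" "\<bar>z\<bar> ^ k \<le> M" "0 \<le> M" unfolding M_def by auto
  show ?thesis
  proof (rule C_lLipI)
    \<comment> \<open>The factor \<open>1 + \<bar>z\<bar>\<close> rather than
      \<open>\<bar>z\<bar>\<close> keeps the constant positive at \<open>z = 0\<close>.\<close>
    show "C * M * (1 + \<bar>z\<bar>) > 0"
      using \<open>C > 0\<close> M by (simp add: add_pos_nonneg)
    fix x y :: real
    have "\<bar>\<phi> (z * x) - \<phi> (z * y)\<bar>
        \<le> C * (1 + norm (z * x) ^ k + norm (z * y) ^ k) * norm (z * x - z * y)"
      by (rule C)
    also have "\<dots> = C * (1 + \<bar>z\<bar> ^ k * norm x ^ k + \<bar>z\<bar> ^ k * norm y ^ k) * (\<bar>z\<bar> * norm (x - y))"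
      by (simp add: abs_mult power_mult_distrib flip: right_diff_distrib)
    also have "\<dots> \<le> C * (M + M * norm x ^ k + M * norm y ^ k) * ((1 + \<bar>z\<bar>) * norm (x - y))"
      using \<open>C > 0\<close> M
      by (intro mult_mono mult_left_mono add_mono mult_right_mono) auto
    also have "\<dots> = C * M * (1 + \<bar>z\<bar>) * (1 + norm x ^ k + norm y ^ k) * norm (x - y)"
      by (simp add: algebra_simps)
    finally show "\<bar>\<phi> (z * x) - \<phi> (z * y)\<bar>
        \<le> C * M * (1 + \<bar>z\<bar>) * (1 + norm x ^ k + norm y ^ k) * norm (x - y)" .
  qed
qed

section \<open>Gaussian integrals of such functions\<close>

lemma integrable_std_normal_abs_power:
  "integrable lborel (\<lambda>y. std_normal_density y * \<bar>y\<bar> ^ k)"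
  using integrable_std_normal_moment_abs[of k] by simp

text \<open>Comparing \<open>\<phi> y\<close> with \<open>\<phi> 0\<close> bounds it by a polynomial
  in \<open>\<bar>y\<bar>\<close>, and all absolute Gaussian moments are finite.\<close>

lemma integrable_std_normal_C_lLip:
  assumes "\<phi> \<in> C_lLip"
  shows "integrable lborel (\<lambda>y. std_normal_density y * \<phi> y)"
proof -
  obtain C k where
    C: "\<And>x y. \<bar>\<phi> x - \<phi> y\<bar> \<le> C * (1 + norm x ^ k + norm y ^ k) * norm (x - y)"
    using C_lLipE[OF assms] by metis
  have [measurable]: "\<phi> \<in> borel_measurable borel"
    using C_lLip_imp_continuous[OF assms] by (rule borel_measurable_continuous_onI)
  \<comment> \<open>Each summand is a moment integrand times a constant. The term
    \<open>0 ^ k\<close> comes from the comparison point 0 and equals 1 when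
    \<open>k = 0\<close>.\<close>
  define B where "B y = std_normal_density y * \<bar>y\<bar> ^ 0 * \<bar>\<phi> 0\<bar>
    + (std_normal_density y * \<bar>y\<bar> ^ 1 * (C * (1 + 0 ^ k)) + std_normal_density y * \<bar>y\<bar> ^ Suc k * C)" for y
  have "integrable lborel B"
    unfolding B_def
    by (intro Bochner_Integration.integrable_add integrable_mult_left integrable_std_normal_abs_power)
  then show ?thesis
  proof (rule Bochner_Integration.integrable_bound)
    show "AE y in lborel. norm (std_normal_density y * \<phi> y) \<le> norm (B y)"
    proof (rule AE_I2)
      fix y :: real
      have "\<bar>\<phi> y\<bar> \<le> \<bar>\<phi> 0\<bar> + C * (1 + \<bar>y\<bar> ^ k + 0 ^ k) * \<bar>y\<bar>"
        using C[of y 0] by simp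
      then have "std_normal_density y * \<bar>\<phi> y\<bar>
          \<le> std_normal_density y * (\<bar>\<phi> 0\<bar> + C * (1 + \<bar>y\<bar> ^ k + 0 ^ k) * \<bar>y\<bar>)"
        by (rule mult_left_mono) simp
      also have "\<dots> = B y"
        unfolding B_def by (simp add: algebra_simps)
      finally show "norm (std_normal_density y * \<phi> y) \<le> norm (B y)"
        by (simp add: abs_mult)
    qed
  qed measurable
qed

text \<open>In the bound for \<open>\<phi> (x * y) - \<phi> (z * y)\<close> the powers of
  \<open>y\<close> separate from those of \<open>x\<close> and \<open>z\<close>. Integrating over
  \<open>y\<close> turns them into moments, so the degree \<open>k\<close> survives and only the
  constant grows, uniformly in \<open>x\<close> and \<open>z\<close>.\<close>

lemma C_lLip_std_normal_mixture:
  assumes "\<phi> \<in> C_lLip"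
  shows "(\<lambda>z. \<integral>y. std_normal_density y * \<phi> (z * y) \<partial>lborel) \<in> C_lLip"
proof -
  obtain C k where "C > 0" and
    C: "\<And>x y. \<bar>\<phi> x - \<phi> y\<bar> \<le> C * (1 + norm x ^ k + norm y ^ k) * norm (x - y)"
    using C_lLipE[OF assms] by metis
  define m where "m j = (\<integral>y. std_normal_density y * \<bar>y\<bar> ^ j \<partial>lborel)" for j :: nat
  have m_nonneg: "0 \<le> m j" for j
    unfolding m_def by (intro Bochner_Integration.integral_nonneg) simp
  \<comment> \<open>Dominates both moments that occur; the summand 1 yields positivity from their
    nonnegativity.\<close>
  define M where "M = 1 + m 1 + m (Suc k)"
  have M: "m 1 \<le> M" "m (Suc k) \<le> M" "0 < M"
    unfolding M_def using m_nonneg[of 1] m_nonneg[of "Suc k"] by auto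
  have int: "integrable lborel (\<lambda>y. std_normal_density y * \<phi> (z * y))" for z
    by (intro integrable_std_normal_C_lLip C_lLip_scale assms)
  show ?thesis
  proof (rule C_lLipI)
    show "C * M > 0" using \<open>C > 0\<close> M by simp
    fix x z :: real
    define c where "c = C * \<bar>x - z\<bar>"
    define B where "B y = std_normal_density y * \<bar>y\<bar> ^ 1 * c
      + std_normal_density y * \<bar>y\<bar> ^ Suc k * (c * (\<bar>x\<bar> ^ k + \<bar>z\<bar> ^ k))" for y
    have intB: "integrable lborel B"
      unfolding B_def
      by (intro Bochner_Integration.integrable_add integrable_mult_left integrable_std_normal_abs_power)
    have bound: "norm (std_normal_density y * \<phi> (x * y) - std_normal_density y * \<phi> (z * y)) \<le> B y" for y
    proof -
      have "\<bar>\<phi> (x * y) - \<phi> (z * y)\<bar>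
          \<le> C * (1 + norm (x * y) ^ k + norm (z * y) ^ k) * norm (x * y - z * y)"
        by (rule C)
      \<comment> \<open>The increment \<open>x * y - z * y\<close> contributes one more factor
        \<open>\<bar>y\<bar>\<close>, hence the moments of orders 1 and
        \<open>Suc k\<close>.\<close>
      also have "\<dots> = c * (\<bar>y\<bar> + (\<bar>x\<bar> ^ k + \<bar>z\<bar> ^ k) * \<bar>y\<bar> ^ Suc k)"
        unfolding c_def left_diff_distrib[symmetric]
        by (simp only: real_norm_def abs_mult power_mult_distrib) (simp add: algebra_simps)
      finally have "std_normal_density y * \<bar>\<phi> (x * y) - \<phi> (z * y)\<bar>
          \<le> std_normal_density y * (c * (\<bar>y\<bar> + (\<bar>x\<bar> ^ k + \<bar>z\<bar> ^ k) * \<bar>y\<bar> ^ Suc k))"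
        by (rule mult_left_mono) simp
      also have "\<dots> = B y"
        unfolding B_def by (simp add: algebra_simps)
      finally show ?thesis
        by (simp add: abs_mult flip: right_diff_distrib)
    qed
    have "\<bar>(\<integral>y. std_normal_density y * \<phi> (x * y) \<partial>lborel)
          - (\<integral>y. std_normal_density y * \<phi> (z * y) \<partial>lborel)\<bar>
        = norm (\<integral>y. std_normal_density y * \<phi> (x * y) - std_normal_density y * \<phi> (z * y) \<partial>lborel)"
      by (simp add: Bochner_Integration.integral_diff[OF int int])
    also have "\<dots> \<le> integral\<^sup>L lborel B"
      using intB bound by (rule Bochner_Integration.integral_norm_bound_integral[OF Bochner_Integration.integrable_diff[OF int int]])
    also have "\<dots> = m 1 * c + m (Suc k) * (c * (\<bar>x\<bar> ^ k + \<bar>z\<bar> ^ k))"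
      unfolding B_def m_def
      by (subst Bochner_Integration.integral_add)
        (intro integrable_mult_left integrable_std_normal_abs_power
          | simp only: integral_mult_left_zero)+
    also have "\<dots> \<le> M * c + M * (c * (\<bar>x\<bar> ^ k + \<bar>z\<bar> ^ k))"
      using M \<open>C > 0\<close> unfolding c_def by (intro add_mono mult_right_mono) auto
    also have "\<dots> = C * M * (1 + norm x ^ k + norm z ^ k) * norm (x - z)"
      unfolding c_def by (simp add: algebra_simps)
    finally show "\<bar>(\<integral>y. std_normal_density y * \<phi> (x * y) \<partial>lborel)
          - (\<integral>y. std_normal_density y * \<phi> (z * y) \<partial>lborel)\<bar>
        \<le> C * M * (1 + norm x ^ k + norm z ^ k) * norm (x - z)" .
  qed
qed

text \<open>Substitute \<open>x = z * y\<close>. In the degenerate case \<open>z = 0\<close> both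
  sides equal \<open>\<phi> 0\<close>, because the standard normal density has total mass 1.\<close>

lemma integral_normal_law_eq:
  fixes \<phi> :: "real \<Rightarrow> real"
  assumes [measurable]: "\<phi> \<in> borel_measurable borel" and "0 \<le> z"
  shows "(\<integral>x. \<phi> x \<partial>(normal_law 0 (z\<^sup>2))) = (\<integral>y. std_normal_density y * \<phi> (z * y) \<partial>lborel)"
proof (cases "z = 0")
  case True
  then show ?thesis
    using integrable_std_normal_abs_power[of 0] prob_space.prob_space[OF prob_space_normal_density[of 1 0]]
    by (simp add: normal_law_def integral_return)
next
  case False
  with \<open>0 \<le> z\<close> have "z > 0" by simp
  \<comment> \<open>The Jacobian \<open>z\<close> cancels the factor \<open>1 / z\<close> in the
    density with standard deviation \<open>z\<close>.\<close>
  then have dens: "z * normal_density 0 z (z * y) = std_normal_density y" for y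
    by (simp add: normal_density_def real_sqrt_mult power_mult_distrib field_simps)
  have "(\<integral>x. \<phi> x \<partial>(normal_law 0 (z\<^sup>2))) = (\<integral>x. normal_density 0 z x * \<phi> x \<partial>lborel)"
    using \<open>z > 0\<close> by (simp add: normal_law_def integral_density)
  also have "\<dots> = \<bar>z\<bar> *\<^sub>R (\<integral>y. normal_density 0 z (0 + z * y) * \<phi> (0 + z * y) \<partial>lborel)"
    by (rule lborel_integral_real_affine) fact
  also have "\<dots> = (\<integral>y. z * normal_density 0 z (z * y) * \<phi> (z * y) \<partial>lborel)"
    using \<open>z > 0\<close> by (simp add: mult.assoc)
  finally show ?thesis by (simp only: dens)
qed

lemma is_max_on_cong:
  assumes "\<And>s. s \<in> S \<Longrightarrow> f s = g s"
  shows "is_max_on S f m \<longleftrightarrow> is_max_on S g m"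
  using assms by (auto simp: is_max_on_def)

theorem theorem3p2:
  fixes \<H> :: "('w \<Rightarrow> real) set" and \<E> :: "('w \<Rightarrow> real) \<Rightarrow> real"
    and W :: "'w \<Rightarrow> real" and \<phi> :: "real \<Rightarrow> real" and \<sigma>l \<sigma>u :: real
  assumes "sublinear_expectation_space \<H> \<E>"
    and "0 \<le> \<sigma>l" and "\<sigma>l \<le> \<sigma>u"
    and "semi_G_normal \<H> \<E> W \<sigma>l \<sigma>u"
    and "\<phi> \<in> C_lLip"
  shows "is_max_on {\<sigma>l..\<sigma>u} (\<lambda>z. \<integral>x. \<phi> x \<partial>(normal_law 0 (z\<^sup>2))) (\<E> (\<lambda>\<omega>. \<phi> (W \<omega>)))
    \<and> is_max_on {\<sigma>l..\<sigma>u}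
        (\<lambda>z. \<integral>y. 1 / sqrt (2 * pi) * exp (- y\<^sup>2 / 2) * \<phi> (z * y) \<partial>lborel)
        (\<E> (\<lambda>\<omega>. \<phi> (W \<omega>)))"
proof -
  obtain Y Z where Y: "standard_normal_distributed \<E> Y"
    and Z: "maximal_distributed \<E> Z \<sigma>l \<sigma>u"
    and indep: "independent_from \<E> Y Z" and W: "W = (\<lambda>\<omega>. Z \<omega> * Y \<omega>)"
    using assms(4) unfolding semi_G_normal_def by blast
  define G where "G z = (\<integral>y. std_normal_density y * \<phi> (z * y) \<partial>lborel)" for z
  have inner: "\<E> (\<lambda>\<omega>. \<phi> (z * Y \<omega>)) = G z" for z
    using Y C_lLip_scale[OF assms(5), of z]
    unfolding standard_normal_distributed_def G_def std_normal_density_def by (rule bspec)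
  have "\<E> (\<lambda>\<omega>. \<phi> (W \<omega>)) = \<E> (\<lambda>\<omega>. \<E> (\<lambda>\<omega>'. \<phi> (Z \<omega> * Y \<omega>')))"
    using indep C_lLip_mult[OF assms(5)] unfolding independent_from_def W by fastforce
  \<comment> \<open>\<open>inner\<close> holds for every real \<open>z\<close>, so it rewrites the
    integrand at each \<open>\<omega>\<close>, wherever \<open>Z \<omega>\<close> lies.\<close>
  also have "\<dots> = \<E> (\<lambda>\<omega>. G (Z \<omega>))"
    by (simp only: inner)
  finally have W_G: "\<E> (\<lambda>\<omega>. \<phi> (W \<omega>)) = \<E> (\<lambda>\<omega>. G (Z \<omega>))" .
  have "G \<in> C_lLip"
    using C_lLip_std_normal_mixture[OF assms(5)] by (simp add: G_def[abs_def])
  \<comment> \<open>Attainment of the maximum is part of the maximal distribution, applied here to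
    the test function \<open>G\<close>.\<close>
  with Z have max: "is_max_on {\<sigma>l..\<sigma>u} G (\<E> (\<lambda>\<omega>. \<phi> (W \<omega>)))"
    unfolding maximal_distributed_def W_G by (rule bspec)
  have "\<phi> \<in> borel_measurable borel"
    using C_lLip_imp_continuous[OF assms(5)] by (rule borel_measurable_continuous_onI)
  \<comment> \<open>Nonnegativity of \<open>\<sigma>l\<close> gives \<open>0 \<le> z\<close> on the
    interval, so the standard deviation \<open>sqrt (z\<^sup>2)\<close> is \<open>z\<close>
    itself.\<close>
  then have "(\<integral>x. \<phi> x \<partial>(normal_law 0 (z\<^sup>2))) = G z" if "z \<in> {\<sigma>l..\<sigma>u}" for z
    using integral_normal_law_eq[of \<phi> z] that assms(2) by (simp add: G_def)
  then have normal: "is_max_on {\<sigma>l..\<sigma>u} (\<lambda>z. \<integral>x. \<phi> x \<partial>(normal_law 0 (z\<^sup>2))) (\<E> (\<lambda>\<omega>. \<phi> (W \<omega>)))"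
    by (rule is_max_on_cong[THEN iffD2, OF _ max])
  have G_eq: "G = (\<lambda>z. \<integral>y. 1 / sqrt (2 * pi) * exp (- y\<^sup>2 / 2) * \<phi> (z * y) \<partial>lborel)"
    by (simp add: G_def[abs_def] std_normal_density_def)
  show ?thesis
    using normal max[unfolded G_eq] by (rule conjI)
qed

end
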